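(* Let $d\ge 1$ and let $(S_n)_{n\ge 0}$ be a transient random walk in $\mathbb{Z}^d$ with escape probability $\gamma\in(0,1)$. Let $J\subset\mathbb{N}=\{1,2,\ldots\}$. Then, with probability $1$, $$\frac1n\sum_{x\in\mathbb{Z}^d}\mathbf{1}\{l(n,x)\in J\}\ \to\ \sum_{j\in J}\gamma^2(1-\gamma)^{j-1}\qquad\text{as } n\to\infty .$$
   Context: $X_1,X_2,\ldots$ are independent identically distributed random vectors with values in $\mathbb{Z}^d$; $S_0:=0$ and $S_n:=X_1+\cdots+X_n$. No moment or other assumptions are made on $X_1$. The escape probability is $\gamma:=\mathbb{P}\{S_n\ne 0\text{ for all } n\ge 1\}$; the walk is transient if $\gamma>0$, and it is assumed throughout that also $\gamma<1$. The local time of $x\in\mathbb{Z}^d$ up to time $n$ is $l(n,x):=\sum_{i=0}^n \mathbf{1}\{S_i=x\}$. *)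

theory Defs
  imports "HOL-Probability.Probability"
begin

(* The lattice Z^d is the type "int ^ 'd" with d = CARD('d), carrying the discrete sigma-algebra.
   The steps are X 1, X 2, ...; the value X 0 is never used. *)

definition iid_steps :: "'a measure \<Rightarrow> (nat \<Rightarrow> 'a \<Rightarrow> int ^ 'd) \<Rightarrow> bool" where
  "iid_steps M X \<longleftrightarrow>
     prob_space.indep_vars M (\<lambda>_. count_space UNIV) X {1..} \<and>
     (\<forall>i\<ge>1. distr M (count_space UNIV) (X i) = distr M (count_space UNIV) (X 1))"

definition walk :: "(nat \<Rightarrow> 'a \<Rightarrow> int ^ 'd) \<Rightarrow> nat \<Rightarrow> 'a \<Rightarrow> int ^ 'd" where
  "walk X n \<omega> = (\<Sum>i=1..n. X i \<omega>)"

definition escape_prob :: "'a measure \<Rightarrow> (nat \<Rightarrow> 'a \<Rightarrow> int ^ 'd) \<Rightarrow> real" where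
  "escape_prob M X = measure M {\<omega> \<in> space M. \<forall>n\<ge>1. walk X n \<omega> \<noteq> 0}"

definition transient :: "'a measure \<Rightarrow> (nat \<Rightarrow> 'a \<Rightarrow> int ^ 'd) \<Rightarrow> bool" where
  "transient M X \<longleftrightarrow> escape_prob M X > 0"

definition local_time :: "(nat \<Rightarrow> 'a \<Rightarrow> int ^ 'd) \<Rightarrow> nat \<Rightarrow> int ^ 'd \<Rightarrow> 'a \<Rightarrow> nat" where
  "local_time X n x \<omega> = (\<Sum>i=0..n. of_bool (walk X i \<omega> = x))"

end

(* Label a site visited at least j times up to time n by the time i of its j-th visit counted from
   the end. Then the number of such sites is the number of i <= n for which S_i is visited exactly j
   times in [i, n]. Up to times i followed by a return to S_i after n, this is the Birkhoff sum of the
   event that the whole walk visits its starting point exactly j times, which has probability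
   g (1 - g)^(j - 1) by decomposing over the last visit. The returns after n cost at most m plus the
   Birkhoff sum of the event of a return after time m, and by transience the probability of that event
   tends to 0 as m grows. Birkhoff's theorem for the shift thus gives the limit for "at least j
   visits"; differences give "exactly j", and the geometric tails allow infinite J. *)

theory Submission
  imports Defs
begin

section \<open>Birkhoff's theorem for ergodic transformations\<close>

text \<open>Ergodicity is tested on sets that equal their preimage exactly. The tail 0-1 law
  supplies it in this form for the shift, and the set of unbounded Birkhoff sums is invariant in
  this sense.\<close>

locale ergodic = prob_space M for M :: "'a measure" +
  fixes T :: "'a \<Rightarrow> 'a"
  assumes T_measurable [measurable]: "T \<in> M \<rightarrow>\<^sub>M M"
    and T_preserves: "distr M M T = M"
    and T_ergodic: "\<And>A. A \<in> sets M \<Longrightarrow> T -` A \<inter> space M = A \<Longrightarrow> prob A = 0 \<or> prob A = 1"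
begin

section \<open>Integrals and sums along orbits\<close>

lemma measurable_funpow_T [measurable]: "T ^^ n \<in> M \<rightarrow>\<^sub>M M"
  by (induction n) auto

lemma integrable_comp_T:
  fixes f :: "'a \<Rightarrow> real"
  assumes "integrable M f"
  shows "integrable M (\<lambda>x. f (T x))"
  using assms integrable_distr[of T M M f] by (simp add: T_preserves)

lemma integral_comp_T:
  fixes f :: "'a \<Rightarrow> real"
  assumes [measurable]: "f \<in> borel_measurable M"
  shows "(\<integral>x. f (T x) \<partial>M) = (\<integral>x. f x \<partial>M)"
  using integral_distr[of T M M f] by (simp add: T_preserves)

definition birkhoff_sum :: "('a \<Rightarrow> real) \<Rightarrow> nat \<Rightarrow> 'a \<Rightarrow> real" where
  "birkhoff_sum f n x = (\<Sum>i<n. f ((T ^^ i) x))"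

text \<open>Splitting off the first term puts the rest at \<open>T x\<close>, which matches the
  recursion of \<open>maximal_sum\<close>.\<close>

lemma birkhoff_sum_Suc: "birkhoff_sum f (Suc n) x = f x + birkhoff_sum f n (T x)"
  unfolding birkhoff_sum_def by (subst sum.lessThan_Suc_shift) (simp add: funpow_swap1)

lemma birkhoff_sum_measurable [measurable]:
  "f \<in> borel_measurable M \<Longrightarrow> birkhoff_sum f n \<in> borel_measurable M"
  unfolding birkhoff_sum_def
  by (intro borel_measurable_sum measurable_compose[OF measurable_funpow_T])

(* The maximum of the Birkhoff sums of orders 0, ..., n. *)
primrec maximal_sum :: "('a \<Rightarrow> real) \<Rightarrow> nat \<Rightarrow> 'a \<Rightarrow> real" where
  "maximal_sum f 0 x = 0"
| "maximal_sum f (Suc n) x = max 0 (f x + maximal_sum f n (T x))"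

lemma maximal_sum_nonneg: "0 \<le> maximal_sum f n x"
  by (cases n) auto

lemma maximal_sum_le_Suc: "maximal_sum f n x \<le> maximal_sum f (Suc n) x"
proof (induction n arbitrary: x)
  case (Suc n)
  show ?case using Suc[of "T x"] by (simp add: max_def)
qed simp

lemma birkhoff_sum_le_maximal_sum: "birkhoff_sum f n x \<le> maximal_sum f n x"
proof (induction n arbitrary: x)
  case (Suc n)
  show ?case using Suc[of "T x"] by (simp add: birkhoff_sum_Suc)
qed (simp add: birkhoff_sum_def)

lemma integrable_maximal_sum:
  assumes "integrable M f"
  shows "integrable M (maximal_sum f n)"
proof (induction n)
  case 0
  show ?case by (simp cong: integrable_cong)
next
  case (Suc n)
  then show ?case using assms integrable_comp_T[OF Suc] by simp
qed

(* Garsia's argument: where the maximal sum m is positive, f exceeds m - m o T. *)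
lemma maximal_ergodic_inequality:
  assumes f: "integrable M f"
  shows "0 \<le> (\<integral>x. f x * indicator {x. maximal_sum f n x > 0} x \<partial>M)"
proof -
  note m = integrable_maximal_sum[OF f, of n]
  note [measurable] = borel_measurable_integrable[OF f] borel_measurable_integrable[OF m]
  \<comment> \<open>Both terms are integrable and, by invariance of the measure, have the same
    integral.\<close>
  have "0 = (\<integral>x. maximal_sum f n x - maximal_sum f n (T x) \<partial>M)"
    using m integrable_comp_T[OF m] by (simp add: integral_comp_T)
  also have "\<dots> \<le> (\<integral>x. f x * indicator {x. maximal_sum f n x > 0} x \<partial>M)"
  proof (rule integral_mono)
    show "integrable M (\<lambda>x. maximal_sum f n x - maximal_sum f n (T x))"
      using m integrable_comp_T[OF m] by simp
    show "integrable M (\<lambda>x. f x * indicator {x. maximal_sum f n x > 0} x)"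
      by (rule Bochner_Integration.integrable_bound[OF f]) (auto simp: indicator_def)
    fix x
    show "maximal_sum f n x - maximal_sum f n (T x) \<le> f x * indicator {x. maximal_sum f n x > 0} x"
    proof (cases "maximal_sum f n x > 0")
      case True
      \<comment> \<open>By monotonicity the maximal sum of order \<open>Suc n\<close> is positive
        too, so the maximum in its recursion is \<open>f x + maximal_sum f n (T x)\<close>, which is
        at least \<open>maximal_sum f n x\<close>.\<close>
      then show ?thesis using maximal_sum_le_Suc[of f n x] by auto
    next
      case False
      then show ?thesis
        using maximal_sum_nonneg[of f n x] maximal_sum_nonneg[of f n "T x"] by auto
    qed
  qed
  finally show ?thesis .
qed

(* The set where the sums are unbounded above is invariant; if it had measure 1, the maximal
   inequality would give a nonnegative integral in the limit. *)
lemma birkhoff_sum_bounded_above: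
  assumes f: "integrable M f" and neg: "(\<integral>x. f x \<partial>M) < 0"
  shows "AE x in M. \<exists>c::nat. \<forall>n. birkhoff_sum f n x \<le> real c"
proof -
  note [measurable] = borel_measurable_integrable[OF f] borel_measurable_integrable[OF integrable_maximal_sum[OF f]]
  define A where "A = {x \<in> space M. \<forall>c::nat. \<exists>n. birkhoff_sum f n x > real c}"
  have A [measurable]: "A \<in> sets M" unfolding A_def by measurable
  have "T x \<in> A \<longleftrightarrow> x \<in> A" if x: "x \<in> space M" for x
  proof
    assume Tx: "T x \<in> A"
    have "\<exists>n. birkhoff_sum f n x > real c" for c :: nat
    proof -
      obtain c' :: nat where "real c - f x \<le> real c'" using real_arch_simple by blast
      moreover obtain n where "birkhoff_sum f n (T x) > real c'" using Tx by (auto simp: A_def)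
      ultimately have "birkhoff_sum f (Suc n) x > real c" by (simp add: birkhoff_sum_Suc)
      then show ?thesis ..
    qed
    then show "x \<in> A" using x by (simp add: A_def)
  next
    assume xA: "x \<in> A"
    have "\<exists>n. birkhoff_sum f n (T x) > real c" for c :: nat
    proof -
      obtain c' :: nat where c': "real c + f x \<le> real c'" using real_arch_simple by blast
      obtain n where n: "birkhoff_sum f n x > real c'" using xA by (auto simp: A_def)
      \<comment> \<open>The order \<open>n\<close> is positive because the empty sum is 0 while
        \<open>c'\<close> is nonnegative.\<close>
      obtain k where "n = Suc k" using n by (cases n) (auto simp: birkhoff_sum_def)
      then have "birkhoff_sum f k (T x) > real c" using n c' by (simp add: birkhoff_sum_Suc)
      then show ?thesis ..
    qed
    then show "T x \<in> A" using measurable_space[OF T_measurable x] by (simp add: A_def)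
  qed
  moreover have "A \<subseteq> space M" by (auto simp: A_def)
  ultimately have "T -` A \<inter> space M = A" by blast
  from T_ergodic[OF A this] have "prob A = 0"
  proof
    assume "prob A = 1"
    then have "AE x in M. x \<in> A" by (simp add: prob_eq_1)
    then have lim: "AE x in M. (\<lambda>n. f x * indicator {x. maximal_sum f n x > 0} x) \<longlonglongrightarrow> f x"
    proof eventually_elim
      case (elim x)
      \<comment> \<open>One positive Birkhoff sum is enough: monotonicity keeps all later maximal
        sums positive, so the indicator is eventually 1.\<close>
      then have "\<exists>n. birkhoff_sum f n x > real 0" unfolding A_def by blast
      then obtain n where "birkhoff_sum f n x > 0" by auto
      then have "maximal_sum f n x > 0" using birkhoff_sum_le_maximal_sum[of f n x] by simp
      then have "maximal_sum f k x > 0" if "k \<ge> n" for k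
        using lift_Suc_mono_le[of "\<lambda>n. maximal_sum f n x", OF maximal_sum_le_Suc that] by simp
      then have "eventually (\<lambda>k. f x * indicator {x. maximal_sum f k x > 0} x = f x) sequentially"
        unfolding eventually_sequentially by (intro exI[of _ n]) simp
      then show ?case by (rule tendsto_eventually)
    qed
    have "(\<lambda>n. \<integral>x. f x * indicator {x. maximal_sum f n x > 0} x \<partial>M) \<longlonglongrightarrow> (\<integral>x. f x \<partial>M)"
      by (rule integral_dominated_convergence[where w = "\<lambda>x. \<bar>f x\<bar>", OF _ _ _ lim])
         (use f in \<open>auto simp: indicator_def\<close>)
    then have "0 \<le> (\<integral>x. f x \<partial>M)"
      by (rule LIMSEQ_le_const) (auto intro: maximal_ergodic_inequality[OF f])
    then show ?thesis using neg by simp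
  qed simp
  then have "AE x in M. x \<notin> A" by (simp add: prob_eq_0)
  moreover have "AE x in M. x \<in> space M" by simp
  ultimately show ?thesis by eventually_elim (auto simp: A_def not_less)
qed

text \<open>Subtracting slightly more than the mean makes the integral negative, so the centred sums
  stay bounded above and their averages are asymptotically at most 0. Tolerances
  \<open>1 / real (Suc k)\<close> keep the exceptional sets countable in number.\<close>

lemma birkhoff_average_upper:
  assumes f: "integrable M f"
  shows "AE x in M. \<forall>k. \<forall>\<^sub>F n in sequentially.
    birkhoff_sum f n x / real n < (\<integral>x. f x \<partial>M) + 1 / real (Suc k)"
  unfolding AE_all_countable
proof
  fix k
  \<comment> \<open>Half of the tolerance makes the centred integral negative; the other half
    absorbs the bound \<open>c\<close> divided by \<open>n\<close>.\<close>
  define e where "e = 1 / (2 * real (Suc k))"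
  have e: "e > 0" "1 / real (Suc k) = 2 * e" by (auto simp: e_def field_simps)
  define g where "g x = f x - ((\<integral>x. f x \<partial>M) + e)" for x
  have "integrable M g" using f by (simp add: g_def[abs_def])
  moreover have "(\<integral>x. g x \<partial>M) < 0" using f e by (simp add: g_def prob_space)
  ultimately have "AE x in M. \<exists>c::nat. \<forall>n. birkhoff_sum g n x \<le> real c"
    by (rule birkhoff_sum_bounded_above)
  then show "AE x in M. \<forall>\<^sub>F n in sequentially.
      birkhoff_sum f n x / real n < (\<integral>x. f x \<partial>M) + 1 / real (Suc k)"
  proof eventually_elim
    case (elim x)
    then obtain c :: nat where c: "\<And>n. birkhoff_sum g n x \<le> real c" by blast
    obtain N where N: "real c / e < real N" using reals_Archimedean2 by blast
    show ?case
    proof (rule eventually_sequentiallyI[of "Suc N"])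
      fix n assume n: "Suc N \<le> n"
      then have "real c / e < real n" using N by simp
      then have "real c < e * real n" using e by (simp add: field_simps)
      moreover have "birkhoff_sum g n x = birkhoff_sum f n x - real n * ((\<integral>x. f x \<partial>M) + e)"
        by (simp add: birkhoff_sum_def g_def sum_subtractf algebra_simps)
      ultimately have "birkhoff_sum f n x < real n * ((\<integral>x. f x \<partial>M) + 2 * e)"
        using c[of n] by (simp add: algebra_simps)
      then show "birkhoff_sum f n x / real n < (\<integral>x. f x \<partial>M) + 1 / real (Suc k)"
        using n unfolding e by (simp add: field_simps)
    qed
  qed
qed

text \<open>The upper bounds for \<open>f\<close> and for its negative enclose the averages from
  both sides.\<close>

theorem birkhoff:
  assumes f: "integrable M f"
  shows "AE x in M. (\<lambda>n. birkhoff_sum f n x / real n) \<longlonglongrightarrow> (\<integral>x. f x \<partial>M)"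
proof -
  have "integrable M (\<lambda>x. - f x)" using f by simp
  from birkhoff_average_upper[OF f] birkhoff_average_upper[OF this] show ?thesis
  proof eventually_elim
    case (elim x)
    show ?case
    proof (rule tendstoI)
      fix e :: real assume "e > 0"
      then obtain k where k: "1 / real (Suc k) < e" using nat_approx_posE by metis
      have minus: "birkhoff_sum (\<lambda>x. - f x) n x = - birkhoff_sum f n x" for n
        by (simp add: birkhoff_sum_def sum_negf)
      have "\<forall>\<^sub>F n in sequentially. birkhoff_sum f n x / real n < (\<integral>x. f x \<partial>M) + 1 / real (Suc k)"
        using elim(1) by blast
      moreover have "\<forall>\<^sub>F n in sequentially.
          birkhoff_sum (\<lambda>x. - f x) n x / real n < (\<integral>x. - f x \<partial>M) + 1 / real (Suc k)"
        using elim(2) by blast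
      ultimately show "\<forall>\<^sub>F n in sequentially. dist (birkhoff_sum f n x / real n) (\<integral>x. f x \<partial>M) < e"
        by eventually_elim (use k in \<open>simp add: minus dist_real_def abs_less_iff\<close>)
    qed
  qed
qed

end

section \<open>The shift on sequences of independent variables\<close>

definition shift :: "(nat \<Rightarrow> 'b) \<Rightarrow> nat \<Rightarrow> 'b" where
  "shift \<omega> = (\<lambda>i. \<omega> (Suc i))"

lemma funpow_shift: "(shift ^^ k) \<omega> i = \<omega> (k + i)"
  by (induction k arbitrary: i) (auto simp: shift_def)

context sequence_space
begin

lemma measurable_shift [measurable]: "shift \<in> S \<rightarrow>\<^sub>M S"
  unfolding shift_def by (rule measurable_PiM_single') (auto simp: space_PiM PiE_def)

lemma measurable_funpow_shift [measurable]: "shift ^^ k \<in> S \<rightarrow>\<^sub>M S"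
  by (induction k) auto

lemma distr_shift: "distr S S shift = S"
  using distr_PiM_reindex[of UNIV "\<lambda>i. M" Suc UNIV] M.prob_space_axioms
  by (simp add: shift_def[abs_def] restrict_UNIV)

lemma indep_coordinates: "P.indep_vars (\<lambda>_. M) (\<lambda>i \<omega>. \<omega> i) (UNIV :: nat set)"
proof (subst P.indep_vars_iff_distr_eq_PiM)
  show "distr S S (\<lambda>x. \<lambda>i\<in>UNIV. x i) = (\<Pi>\<^sub>M i\<in>UNIV. distr S M (\<lambda>\<omega>. \<omega> i))"
    by (simp add: PiM_component distr_id2 restrict_UNIV)
qed auto

text \<open>An invariant set equals its preimage under every iterate of the shift, hence depends
  only on the coordinates from \<open>n\<close> on, for every \<open>n\<close>. It is a tail event
  of independent coordinates, and Kolmogorov's 0-1 law applies.\<close>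

lemma shift_invariant_0_1:
  assumes A: "A \<in> sets S" and inv: "shift -` A \<inter> space S = A"
  shows "P.prob A = 0 \<or> P.prob A = 1"
proof -
  define F where "F i = sigma_sets (space S) {(\<lambda>\<omega>. \<omega> i) -` B \<inter> space S | B. B \<in> sets M}" for i :: nat
  have F_sub: "F i \<subseteq> Pow (space S)" for i
    unfolding F_def by (intro subsetI PowI sigma_sets_into_sp[rotated]) auto
  have "A \<in> sigma_sets (space S) (\<Union>(F ` {n..}))" for n
  proof -
    have inv_n: "(shift ^^ n) -` A \<inter> space S = A"
    proof (induction n)
      case (Suc n)
      have "(shift ^^ Suc n) -` A \<inter> space S = shift -` ((shift ^^ n) -` A \<inter> space S) \<inter> space S"
        using measurable_space[OF measurable_shift] by (auto simp: funpow_swap1)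
      then show ?case using Suc inv by (simp only:)
    qed (use sets.sets_into_space[OF A] in auto)
    define N where "N = sigma (space S) (\<Union>(F ` {n..}))"
    have N: "space N = space S" "sets N = sigma_sets (space S) (\<Union>(F ` {n..}))"
      using F_sub by (auto simp: N_def space_measure_of_conv sets_measure_of UN_subset_iff)
    \<comment> \<open>Coordinate \<open>i\<close> after \<open>n\<close> shifts is coordinate
      \<open>n + i\<close>, so the iterate reads only coordinates that generate
      \<open>N\<close>.\<close>
    have "shift ^^ n \<in> N \<rightarrow>\<^sub>M S"
    proof (rule measurable_PiM_single')
      fix i :: nat
      show "(\<lambda>\<omega>. (shift ^^ n) \<omega> i) \<in> N \<rightarrow>\<^sub>M M"
      proof (rule measurableI)
        fix B assume B: "B \<in> sets M"
        have "(\<lambda>\<omega>. \<omega> (n + i)) -` B \<inter> space S \<in> F (n + i)"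
          unfolding F_def by (rule sigma_sets.Basic) (use B in blast)
        then show "(\<lambda>\<omega>. (shift ^^ n) \<omega> i) -` B \<inter> space N \<in> sets N"
          unfolding N funpow_shift by (intro sigma_sets.Basic) auto
      qed (auto simp: N funpow_shift space_PiM)
    qed (auto simp: N space_PiM funpow_shift PiE_def)
    from measurable_sets[OF this A] show ?thesis
      using inv_n by (simp add: N)
  qed
  then have "A \<in> P.tail_events F" by (simp add: P.tail_events_def)
  moreover have "P.indep_sets F UNIV"
    using indep_coordinates by (simp add: P.indep_vars_def F_def[abs_def])
  moreover have "sigma_algebra (space S) (F i)" for i
    unfolding F_def by (rule sigma_algebra_sigma_sets) auto
  ultimately show ?thesis by (intro P.kolmogorov_0_1_law)
qed

sublocale shift: ergodic S shift
proof
  show "shift \<in> S \<rightarrow>\<^sub>M S" by (rule measurable_shift)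
  show "distr S S shift = S" by (rule distr_shift)
  show "P.prob A = 0 \<or> P.prob A = 1" if "A \<in> sets S" "shift -` A \<inter> space S = A" for A
    using that by (rule shift_invariant_0_1)
qed

text \<open>Independence of past and future at time \<open>k\<close>. Gluing the first
  \<open>k\<close> entries of one sequence to another independent one by \<open>comb_seq\<close>
  preserves the law, and under this map the event becomes the rectangle
  \<open>C \<times> B\<close>.\<close>

lemma prob_Int_shift:
  assumes C [measurable]: "C \<in> sets S" and B [measurable]: "B \<in> sets S"
    and prefix: "\<And>\<omega> \<omega>'. (\<And>i. i < k \<Longrightarrow> \<omega> i = \<omega>' i) \<Longrightarrow> \<omega> \<in> C \<longleftrightarrow> \<omega>' \<in> C"
  shows "P.prob {\<omega> \<in> C. (shift ^^ k) \<omega> \<in> B} = P.prob C * P.prob B"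
proof -
  define D where "D = {\<omega> \<in> C. (shift ^^ k) \<omega> \<in> B}"
  have D [measurable]: "D \<in> sets S"
  proof -
    have "D = C \<inter> ((shift ^^ k) -` B \<inter> space S)"
      using sets.sets_into_space[OF C] by (auto simp: D_def)
    also have "\<dots> \<in> sets S" by (intro sets.Int C measurable_sets[OF measurable_funpow_shift B])
    finally show ?thesis .
  qed
  have shift_comb: "(shift ^^ k) (comb_seq k \<omega> \<omega>') = \<omega>'" for \<omega> \<omega>' :: "nat \<Rightarrow> 'a"
    by (rule ext) (simp add: funpow_shift comb_seq_def)
  have comb_C: "comb_seq k \<omega> \<omega>' \<in> C \<longleftrightarrow> \<omega> \<in> C" for \<omega> \<omega>'
    by (rule prefix) (simp add: comb_seq_def)
  let ?c = "\<lambda>(\<omega>, \<omega>'). comb_seq k \<omega> \<omega>'"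
  have "emeasure S D = emeasure (distr (S \<Otimes>\<^sub>M S) S ?c) D" by (simp add: PiM_comb_seq)
  also have "\<dots> = emeasure (S \<Otimes>\<^sub>M S) (?c -` D \<inter> space (S \<Otimes>\<^sub>M S))"
    by (rule emeasure_distr[OF measurable_comb_seq D])
  also have "?c -` D \<inter> space (S \<Otimes>\<^sub>M S) = C \<times> B"
    using sets.sets_into_space[OF C] sets.sets_into_space[OF B]
    by (auto simp: D_def comb_C shift_comb space_pair_measure)
  also have "emeasure (S \<Otimes>\<^sub>M S) (C \<times> B) = emeasure S C * emeasure S B"
    by (rule P.emeasure_pair_measure_Times[OF C B])
  finally show ?thesis
    by (simp add: D_def measure_def enn2real_mult)
qed

end

section \<open>Occupation counts of a path\<close>

text \<open>Ranks of successive elements grow by one, so each rank up to the size of the set is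
  attained. This lets an event about all zeros be split by the time of the \<open>j\<close>-th
  one.\<close>

lemma ex_rank_eq_iff:
  fixes Z :: "nat set"
  assumes "j \<ge> 1"
  shows "(\<exists>k\<in>Z. card (Z \<inter> {..k}) = j) \<longleftrightarrow> infinite Z \<or> j \<le> card Z"
proof
  assume "\<exists>k\<in>Z. card (Z \<inter> {..k}) = j"
  then show "infinite Z \<or> j \<le> card Z" by (auto intro: card_mono)
next
  show "infinite Z \<or> j \<le> card Z \<Longrightarrow> \<exists>k\<in>Z. card (Z \<inter> {..k}) = j"
    using assms
  proof (induction j rule: dec_induct)
    case base
    then have "Z \<noteq> {}" by auto
    then have "(LEAST k. k \<in> Z) \<in> Z" by (auto intro: LeastI)
    moreover from this have "Z \<inter> {..LEAST k. k \<in> Z} = {LEAST k. k \<in> Z}"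
      by (auto intro: Least_le antisym)
    ultimately show ?case by (metis card_1_singleton_iff One_nat_def)
  next
    case (step j)
    then obtain k where k: "k \<in> Z" "card (Z \<inter> {..k}) = j" by auto
    have "\<exists>l. l \<in> Z \<and> l > k"
    proof (rule ccontr)
      assume "\<nexists>l. l \<in> Z \<and> l > k"
      then have eq: "Z \<inter> {..k} = Z" by (auto simp: not_less)
      then have "finite Z" by (metis finite_Int finite_atMost)
      then show False using step.prems k eq by auto
    qed
    \<comment> \<open>The next element of \<open>Z\<close> after \<open>k\<close> raises the rank by
      exactly one.\<close>
    define l where "l = (LEAST l. l \<in> Z \<and> l > k)"
    have l: "l \<in> Z" "l > k" using LeastI_ex[OF \<open>\<exists>l. l \<in> Z \<and> l > k\<close>] by (auto simp: l_def)
    have "i \<le> k" if "i \<in> Z" "i < l" for i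
      using not_less_Least[of i "\<lambda>l. l \<in> Z \<and> l > k"] that by (auto simp: l_def)
    then have "Z \<inter> {..l} = insert l (Z \<inter> {..k})"
      using l by (auto simp: le_less)
    moreover have "l \<notin> Z \<inter> {..k}" using l by auto
    ultimately have "card (Z \<inter> {..l}) = Suc j" using k by simp
    then show ?case using l by blast
  qed
qed

text \<open>The \<open>j\<close>-th element from the top has rank \<open>card W - j + 1\<close> from
  the bottom; the extra 1 arises because the element itself is counted from both sides.\<close>

lemma ex_corank_eq:
  fixes W :: "nat set"
  assumes W: "finite W" and j: "1 \<le> j" "j \<le> card W"
  obtains i where "i \<in> W" "card (W \<inter> {i..}) = j"
proof -
  have "\<exists>i\<in>W. card (W \<inter> {..i}) = card W - j + 1"
    using j by (subst ex_rank_eq_iff) auto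
  then obtain i where i: "i \<in> W" "card (W \<inter> {..i}) = card W - j + 1" by blast
  have "card (W \<inter> {..i} \<union> W \<inter> {i..}) + card ((W \<inter> {..i}) \<inter> (W \<inter> {i..}))
      = card (W \<inter> {..i}) + card (W \<inter> {i..})"
    using W by (intro card_Un_Int[symmetric]) auto
  moreover have "W \<inter> {..i} \<union> W \<inter> {i..} = W" by auto
  moreover have "(W \<inter> {..i}) \<inter> (W \<inter> {i..}) = {i}" using i by auto
  ultimately have "card (W \<inter> {i..}) = j" using i j by simp
  with i that show thesis by blast
qed

section \<open>Counts of visits along a path\<close>

definition occupation :: "(nat \<Rightarrow> 'b) \<Rightarrow> nat \<Rightarrow> 'b \<Rightarrow> nat" where
  "occupation s n x = card {k. k \<le> n \<and> s k = x}"

text \<open>Time \<open>i\<close> itself is counted, so the last visit to a site up to time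
  \<open>n\<close> has value 1.\<close>

definition later_visits :: "(nat \<Rightarrow> 'b) \<Rightarrow> nat \<Rightarrow> nat \<Rightarrow> nat" where
  "later_visits s n i = card {k. i \<le> k \<and> k \<le> n \<and> s k = s i}"

text \<open>Without 0 in \<open>J\<close>, every such site is one of the values of the path up to
  time \<open>n\<close>. This makes \<open>card\<close> a true count throughout.\<close>

lemma finite_occupied: "0 \<notin> J \<Longrightarrow> finite {x. occupation s n x \<in> J}"
proof (rule finite_subset)
  assume "0 \<notin> J"
  show "{x. occupation s n x \<in> J} \<subseteq> s ` {..n}"
  proof
    fix x assume "x \<in> {x. occupation s n x \<in> J}"
    with \<open>0 \<notin> J\<close> have "occupation s n x \<noteq> 0" by (metis mem_Collect_eq)
    then have "{k. k \<le> n \<and> s k = x} \<noteq> {}" unfolding occupation_def by (metis card.empty)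
    then show "x \<in> s ` {..n}" by auto
  qed
qed auto

(* A site visited at least j times is labelled by the time of its j-th visit from the end.
   Counting from the end makes each label a function of the future of the walk only. *)
lemma card_occupation_ge:
  assumes "j \<ge> 1"
  shows "card {x. j \<le> occupation s n x} = card {i. i \<le> n \<and> later_visits s n i = j}"
proof -
  have "bij_betw s {i. i \<le> n \<and> later_visits s n i = j} {x. j \<le> occupation s n x}"
    unfolding bij_betw_def
  proof
    \<comment> \<open>Of two visits to the same site, the earlier one has strictly more visits still
      to come, so a site cannot carry two labels.\<close>
    have less: False
      if "i < i'" "i' \<le> n" "s i = s i'" "later_visits s n i = j" "later_visits s n i' = j" for i i'
    proof -
      have "{k. i' \<le> k \<and> k \<le> n \<and> s k = s i'} \<subset> {k. i \<le> k \<and> k \<le> n \<and> s k = s i}"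
      proof
        show "{k. i' \<le> k \<and> k \<le> n \<and> s k = s i'} \<subseteq> {k. i \<le> k \<and> k \<le> n \<and> s k = s i}"
          using that by auto
        have "i \<in> {k. i \<le> k \<and> k \<le> n \<and> s k = s i}" "i \<notin> {k. i' \<le> k \<and> k \<le> n \<and> s k = s i'}"
          using that by auto
        then show "{k. i' \<le> k \<and> k \<le> n \<and> s k = s i'} \<noteq> {k. i \<le> k \<and> k \<le> n \<and> s k = s i}"
          by blast
      qed
      moreover have "finite {k. i \<le> k \<and> k \<le> n \<and> s k = s i}" by simp
      ultimately have "later_visits s n i' < later_visits s n i"
        unfolding later_visits_def by (rule psubset_card_mono[rotated])
      then show False using that by simp
    qed
    show "inj_on s {i. i \<le> n \<and> later_visits s n i = j}"
    proof (rule inj_onI)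
      fix i i' assume "i \<in> {i. i \<le> n \<and> later_visits s n i = j}"
        "i' \<in> {i. i \<le> n \<and> later_visits s n i = j}" "s i = s i'"
      then show "i = i'" using less[of i i'] less[of i' i] by (cases i i' rule: linorder_cases) auto
    qed
    show "s ` {i. i \<le> n \<and> later_visits s n i = j} = {x. j \<le> occupation s n x}"
    proof (intro equalityI subsetI)
      fix x assume "x \<in> s ` {i. i \<le> n \<and> later_visits s n i = j}"
      then obtain i where i: "x = s i" "later_visits s n i = j" by auto
      have "later_visits s n i \<le> occupation s n (s i)"
        unfolding later_visits_def occupation_def by (rule card_mono) auto
      then show "x \<in> {x. j \<le> occupation s n x}" using i by simp
    next
      fix x assume "x \<in> {x. j \<le> occupation s n x}"
      then obtain i where i: "i \<in> {k. k \<le> n \<and> s k = x}" "card ({k. k \<le> n \<and> s k = x} \<inter> {i..}) = j"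
        using assms by (auto simp: occupation_def elim: ex_corank_eq[rotated 2])
      have "{k. k \<le> n \<and> s k = x} \<inter> {i..} = {k. i \<le> k \<and> k \<le> n \<and> s k = s i}" using i by auto
      then show "x \<in> s ` {i. i \<le> n \<and> later_visits s n i = j}"
        using i by (auto simp: later_visits_def)
    qed
  qed
  then show ?thesis by (rule bij_betw_same_card[symmetric])
qed

text \<open>The error need not vanish for fixed \<open>m\<close>: it suffices that its limit in
  \<open>n\<close> tends to 0 as \<open>m\<close> grows. It serves both for the returns after time
  \<open>n\<close> and for the truncation of \<open>J\<close>.\<close>

lemma tendsto_approx:
  fixes a :: "nat \<Rightarrow> real" and b c :: "nat \<Rightarrow> nat \<Rightarrow> real"
  assumes bound: "\<And>m n. \<bar>a n - b m n\<bar> \<le> c m n"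
    and b: "\<And>m. b m \<longlonglongrightarrow> \<beta> m" and c: "\<And>m. c m \<longlonglongrightarrow> \<delta> m"
    and \<beta>: "\<beta> \<longlonglongrightarrow> L" and \<delta>: "\<delta> \<longlonglongrightarrow> 0"
  shows "a \<longlonglongrightarrow> L"
proof (rule tendstoI)
  \<comment> \<open>Four quarters are spent: two on \<open>c m n\<close>, by way of
    \<open>\<delta> m\<close>, one on \<open>b m n\<close> against \<open>\<beta> m\<close>, and one
    on \<open>\<beta> m\<close> against \<open>L\<close>.\<close>
  fix e :: real assume e: "e > 0"
  have "\<forall>\<^sub>F m in sequentially. dist (\<beta> m) L < e / 4" "\<forall>\<^sub>F m in sequentially. dist (\<delta> m) 0 < e / 4"
    using e by (intro tendstoD[OF \<beta>] tendstoD[OF \<delta>], simp)+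
  then have "\<forall>\<^sub>F m in sequentially. dist (\<beta> m) L < e / 4 \<and> dist (\<delta> m) 0 < e / 4"
    by (rule eventually_conj)
  then obtain m where m: "dist (\<beta> m) L < e / 4" "dist (\<delta> m) 0 < e / 4"
    using eventually_happens'[OF sequentially_bot] by blast
  have "\<forall>\<^sub>F n in sequentially. dist (b m n) (\<beta> m) < e / 4" "\<forall>\<^sub>F n in sequentially. dist (c m n) (\<delta> m) < e / 4"
    using e by (intro tendstoD[OF b[of m]] tendstoD[OF c[of m]], simp)+
  then show "\<forall>\<^sub>F n in sequentially. dist (a n) L < e"
  proof eventually_elim
    case (elim n)
    then show ?case using m bound[of n m] unfolding dist_real_def by linarith
  qed
qed

text \<open>A statement about a single path. Consecutive limits for "at least" differ by the weight
  for "exactly \<open>j\<close>". Cutting \<open>J\<close> at \<open>K\<close> loses only sites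
  visited more than \<open>K\<close> times, whose density tends to
  \<open>g * (1 - g) ^ K\<close>.\<close>

lemma card_occupation_limit:
  fixes s :: "nat \<Rightarrow> 'b"
  assumes ge: "\<And>j. j \<ge> 1 \<Longrightarrow> (\<lambda>n. real (card {x. j \<le> occupation s n x}) / real n) \<longlonglongrightarrow> g * (1 - g) ^ (j - 1)"
    and g: "0 < g" "g \<le> 1" and J: "J \<subseteq> {1..}"
  shows "(\<lambda>n. real (card {x. occupation s n x \<in> J}) / real n) \<longlonglongrightarrow> (\<Sum>\<^sub>\<infinity>j\<in>J. g\<^sup>2 * (1 - g) ^ (j - 1))"
proof -
  \<comment> \<open>Truncated subtraction gives \<open>q 0\<close> the value of \<open>q 1\<close>;
    this value enters no sum over \<open>J\<close>, since 0 is not in \<open>J\<close>.\<close>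
  define q where "q j = g\<^sup>2 * (1 - g) ^ (j - 1)" for j
  define J' where "J' K = J \<inter> {..K}" for K
  have q_nonneg: "q j \<ge> 0" for j using g by (simp add: q_def)
  have "summable (\<lambda>j. g\<^sup>2 * (1 - g) ^ j)" using g by (intro summable_mult summable_geometric) auto
  then have "summable (\<lambda>j. q (Suc j))" by (simp add: q_def)
  then have "summable q" by (subst (asm) summable_Suc_iff)
  then have q: "q summable_on UNIV"
    using q_nonneg by (intro norm_summable_imp_summable_on) simp
  \<comment> \<open>Extension by 0 outside \<open>J\<close> turns the unordered sum into a limit of
    partial sums over initial segments.\<close>
  have "((\<lambda>j. if j \<in> J then q j else 0) has_sum (\<Sum>\<^sub>\<infinity>j\<in>J. q j)) UNIV"
    using has_sum_infsum[OF summable_on_subset_banach[OF q subset_UNIV[of J]]]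
    by (subst (asm) has_sum_cong_neutral[where T = UNIV and g = "\<lambda>j. if j \<in> J then q j else 0"]) auto
  then have "(\<lambda>K. \<Sum>j<K. if j \<in> J then q j else 0) \<longlonglongrightarrow> (\<Sum>\<^sub>\<infinity>j\<in>J. q j)"
    unfolding sums_def[symmetric] by (rule has_sum_imp_sums)
  then have "(\<lambda>K. \<Sum>j<Suc K. if j \<in> J then q j else 0) \<longlonglongrightarrow> (\<Sum>\<^sub>\<infinity>j\<in>J. q j)"
    by (rule LIMSEQ_Suc)
  moreover have "(\<Sum>j<Suc K. if j \<in> J then q j else 0) = (\<Sum>j\<in>J' K. q j)" for K
    unfolding J'_def lessThan_Suc_atMost Int_commute[of J] by (rule sum.inter_restrict[symmetric]) simp
  ultimately have \<beta>: "(\<lambda>K. \<Sum>j\<in>J' K. q j) \<longlonglongrightarrow> (\<Sum>\<^sub>\<infinity>j\<in>J. q j)" by simp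
  have fin: "finite {x. occupation s n x \<in> A}" if "A \<subseteq> {1..}" for A n
    by (rule finite_occupied) (use that in auto)
  have fin_ge: "finite {x. j \<le> occupation s n x}" if "j \<ge> 1" for j n
    using fin[of "{j..}"] that by simp
  have exact: "(\<lambda>n. real (card {x. occupation s n x = j}) / real n) \<longlonglongrightarrow> q j" if j: "j \<ge> 1" for j
  proof -
    have "real (card {x. j \<le> occupation s n x})
        = real (card {x. occupation s n x = j}) + real (card {x. Suc j \<le> occupation s n x})" for n
    proof -
      have "{x. j \<le> occupation s n x} = {x. occupation s n x = j} \<union> {x. Suc j \<le> occupation s n x}"
        by auto
      then show ?thesis
        using fin[of "{j}" n] fin_ge[of "Suc j" n] j by (simp add: card_Un_disjoint disjoint_iff)
    qed
    then have eq: "real (card {x. occupation s n x = j}) / real n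
        = real (card {x. j \<le> occupation s n x}) / real n - real (card {x. Suc j \<le> occupation s n x}) / real n" for n
      by (simp add: diff_divide_distrib[symmetric])
    have "q j = g * (1 - g) ^ (j - 1) - g * (1 - g) ^ (Suc j - 1)"
      using j by (cases j) (auto simp: q_def power2_eq_square algebra_simps)
    then show ?thesis unfolding eq using ge[of j] ge[of "Suc j"] j by (auto intro!: tendsto_diff)
  qed
  have "(\<lambda>n. real (card {x. occupation s n x \<in> J}) / real n) \<longlonglongrightarrow> (\<Sum>\<^sub>\<infinity>j\<in>J. q j)"
  proof (rule tendsto_approx[where b = "\<lambda>K n. \<Sum>j\<in>J' K. real (card {x. occupation s n x = j}) / real n"
        and c = "\<lambda>K n. real (card {x. Suc K \<le> occupation s n x}) / real n", OF _ _ _ \<beta>])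
    show "(\<lambda>n. \<Sum>j\<in>J' K. real (card {x. occupation s n x = j}) / real n) \<longlonglongrightarrow> (\<Sum>j\<in>J' K. q j)" for K
      by (rule tendsto_sum, rule exact) (use J in \<open>auto simp: J'_def\<close>)
    show "(\<lambda>n. real (card {x. Suc K \<le> occupation s n x}) / real n) \<longlonglongrightarrow> g * (1 - g) ^ K" for K
      using ge[of "Suc K"] by simp
    show "(\<lambda>K. g * (1 - g) ^ K) \<longlonglongrightarrow> 0"
      using g by (intro tendsto_mult_right_zero LIMSEQ_power_zero) auto
    fix K n
    have J'_sub: "J' K \<subseteq> {1..}" using J by (auto simp: J'_def)
    have "card {x. occupation s n x \<in> J' K} = card (\<Union>j\<in>J' K. {x. occupation s n x = j})"
      by (rule arg_cong[of _ _ card]) auto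
    also have "\<dots> = (\<Sum>j\<in>J' K. card {x. occupation s n x = j})"
    proof (rule card_UN_disjoint)
      show "\<forall>j\<in>J' K. finite {x. occupation s n x = j}" using fin[of "{_}" n] J'_sub by auto
    qed (auto simp: J'_def)
    finally have sum: "(\<Sum>j\<in>J' K. real (card {x. occupation s n x = j}) / real n)
        = real (card {x. occupation s n x \<in> J' K}) / real n"
      by (simp add: sum_divide_distrib)
    have "card {x. occupation s n x \<in> J' K} \<le> card {x. occupation s n x \<in> J}"
      by (rule card_mono[OF fin[OF J]]) (auto simp: J'_def)
    moreover have "card {x. occupation s n x \<in> J}
        \<le> card ({x. occupation s n x \<in> J' K} \<union> {x. Suc K \<le> occupation s n x})"
      using fin[OF J'_sub] fin_ge[of "Suc K"] by (intro card_mono) (auto simp: J'_def)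
    moreover have "\<dots> \<le> card {x. occupation s n x \<in> J' K} + card {x. Suc K \<le> occupation s n x}"
      by (rule card_Un_le)
    ultimately have "\<bar>real (card {x. occupation s n x \<in> J}) - real (card {x. occupation s n x \<in> J' K})\<bar>
        \<le> real (card {x. Suc K \<le> occupation s n x})" by linarith
    then show "\<bar>real (card {x. occupation s n x \<in> J}) / real n -
        (\<Sum>j\<in>J' K. real (card {x. occupation s n x = j}) / real n)\<bar>
        \<le> real (card {x. Suc K \<le> occupation s n x}) / real n"
      unfolding sum by (simp add: diff_divide_distrib[symmetric] divide_right_mono)
  qed
  then show ?thesis by (simp add: q_def)
qed

section \<open>Visits of a random walk to its starting point\<close>

text \<open>Steps are numbered from 0, so that the walk lives on the coordinate space of the shift;
  entry \<open>i\<close> leads from time \<open>i\<close> to time \<open>i + 1\<close>.\<close>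

definition position :: "(nat \<Rightarrow> 'b::ab_group_add) \<Rightarrow> nat \<Rightarrow> 'b" where
  "position \<omega> n = (\<Sum>i<n. \<omega> i)"

definition zeros :: "(nat \<Rightarrow> 'b::ab_group_add) \<Rightarrow> nat set" where
  "zeros \<omega> = {k. position \<omega> k = 0}"

section \<open>The walk restarted at a later time\<close>

lemma zero_in_zeros: "0 \<in> zeros \<omega>"
  by (simp add: zeros_def position_def)

text \<open>Shifting by \<open>i\<close> restarts the walk at time \<open>i\<close> and recentres it
  at its current site, so that returns to this site become zeros.\<close>

lemma position_shift: "position ((shift ^^ i) \<omega>) k = position \<omega> (i + k) - position \<omega> i"
  by (induction k) (simp_all add: position_def funpow_shift algebra_simps)

lemma zeros_shift: "zeros ((shift ^^ i) \<omega>) = {k. position \<omega> (i + k) = position \<omega> i}"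
  by (simp add: zeros_def position_shift)

lemma position_cong: "(\<And>i. i < k \<Longrightarrow> \<omega> i = \<omega>' i) \<Longrightarrow> position \<omega> k = position \<omega>' k"
  by (simp add: position_def)

text \<open>With no return after \<open>n\<close>, the visits between \<open>i\<close> and
  \<open>n\<close> are all visits from \<open>i\<close> on; translating time by \<open>i\<close>
  matches them with the zeros of the restarted walk.\<close>

lemma later_visits_shift:
  assumes no_return: "\<And>k. k > n \<Longrightarrow> position \<omega> k \<noteq> position \<omega> i" and "i \<le> n"
  shows "finite (zeros ((shift ^^ i) \<omega>))"
    and "card (zeros ((shift ^^ i) \<omega>)) = later_visits (position \<omega>) n i"
proof -
  have eq: "{k. i \<le> k \<and> k \<le> n \<and> position \<omega> k = position \<omega> i} = (+) i ` zeros ((shift ^^ i) \<omega>)"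
  proof (intro equalityI subsetI)
    fix k assume "k \<in> {k. i \<le> k \<and> k \<le> n \<and> position \<omega> k = position \<omega> i}"
    then show "k \<in> (+) i ` zeros ((shift ^^ i) \<omega>)"
      by (intro image_eqI[of _ _ "k - i"]) (auto simp: zeros_shift)
  next
    fix k assume "k \<in> (+) i ` zeros ((shift ^^ i) \<omega>)"
    then show "k \<in> {k. i \<le> k \<and> k \<le> n \<and> position \<omega> k = position \<omega> i}"
      using no_return by (auto simp: zeros_shift not_less[symmetric])
  qed
  have "finite {k. i \<le> k \<and> k \<le> n \<and> position \<omega> k = position \<omega> i}" by simp
  then show "finite (zeros ((shift ^^ i) \<omega>))"
    unfolding eq by (rule finite_imageD) simp
  show "card (zeros ((shift ^^ i) \<omega>)) = later_visits (position \<omega>) n i"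
    unfolding later_visits_def eq by (simp add: card_image)
qed

text \<open>The walk is treated in a countable abelian group with the discrete sigma-algebra;
  countability makes sums of steps measurable.\<close>

locale group_walk = sequence_space M for M :: "'b::{countable, ab_group_add} measure" +
  assumes sets_M: "sets M = UNIV"
begin

section \<open>Events counting visits to the starting point\<close>

definition no_return :: "(nat \<Rightarrow> 'b) set" where
  "no_return = {\<omega> \<in> space S. \<forall>n\<ge>1. position \<omega> n \<noteq> 0}"

text \<open>Infinitely many zeros form a separate alternative because \<open>card\<close> is 0 on
  infinite sets.\<close>

definition visits_ge :: "nat \<Rightarrow> (nat \<Rightarrow> 'b) set" where
  "visits_ge j = {\<omega> \<in> space S. infinite (zeros \<omega>) \<or> j \<le> card (zeros \<omega>)}"

definition visits_eq :: "nat \<Rightarrow> (nat \<Rightarrow> 'b) set" where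
  "visits_eq j = {\<omega> \<in> space S. finite (zeros \<omega>) \<and> card (zeros \<omega>) = j}"

text \<open>Time \<open>k\<close> is the \<open>j\<close>-th zero, time 0 being the first.
  Membership depends only on the first \<open>k\<close> steps, as independence at time
  \<open>k\<close> requires.\<close>

definition visit_at :: "nat \<Rightarrow> nat \<Rightarrow> (nat \<Rightarrow> 'b) set" where
  "visit_at j k = {\<omega> \<in> space S. k \<in> zeros \<omega> \<and> card (zeros \<omega> \<inter> {..k}) = j}"

definition visit_after :: "nat \<Rightarrow> (nat \<Rightarrow> 'b) set" where
  "visit_after m = {\<omega> \<in> space S. \<exists>k>m. k \<in> zeros \<omega>}"

section \<open>Measurability and decompositions of these events\<close>

lemma space_S: "space S = UNIV"
proof -
  have "space M = UNIV" using sets.top[of M] sets.sets_into_space[of _ M] sets_M by blast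
  then show ?thesis by (simp add: space_PiM PiE_def)
qed

lemma measurable_position [measurable]: "(\<lambda>\<omega>. position \<omega> k) \<in> S \<rightarrow>\<^sub>M count_space UNIV"
proof (induction k)
  case 0
  show ?case by (simp add: position_def)
next
  case (Suc k)
  have "sets M = sets (count_space UNIV)" by (simp add: sets_M)
  then have "M \<rightarrow>\<^sub>M count_space UNIV = count_space UNIV \<rightarrow>\<^sub>M (count_space UNIV :: 'b measure)"
    by (rule measurable_cong_sets) simp
  then have id: "(\<lambda>x. x) \<in> M \<rightarrow>\<^sub>M (count_space UNIV :: 'b measure)" by simp
  have [measurable]: "(\<lambda>\<omega>. \<omega> k) \<in> S \<rightarrow>\<^sub>M count_space UNIV"
    by (rule measurable_compose[OF _ id]) (rule measurable_component_singleton, rule UNIV_I)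
  \<comment> \<open>The sum is measurable by splitting over the countably many values
    \<open>x\<close> of the current position.\<close>
  have "(\<lambda>\<omega>. (\<lambda>x \<omega>. x + \<omega> k) (position \<omega> k) \<omega>) \<in> S \<rightarrow>\<^sub>M count_space UNIV"
  proof (rule measurable_compose_countable[OF _ Suc])
    fix x :: 'b
    show "(\<lambda>\<omega>. x + \<omega> k) \<in> S \<rightarrow>\<^sub>M count_space UNIV"
      by (rule measurable_compose[of "\<lambda>\<omega>. \<omega> k" _ "count_space UNIV"]) auto
  qed
  then show ?case by (simp add: position_def)
qed

lemma measurable_zeros [measurable]: "Measurable.pred S (\<lambda>\<omega>. k \<in> zeros \<omega>)"
  unfolding zeros_def by measurable

lemma no_return_sets [measurable]: "no_return \<in> sets S"
  unfolding no_return_def by measurable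

lemma visit_at_sets [measurable]: "visit_at j k \<in> sets S"
proof -
  have [measurable]: "(\<lambda>\<omega>. card (zeros \<omega> \<inter> {..k})) \<in> S \<rightarrow>\<^sub>M count_space UNIV"
    by (rule measurable_card) (simp, measurable)
  show ?thesis unfolding visit_at_def by measurable
qed

lemma visit_after_sets [measurable]: "visit_after m \<in> sets S"
  unfolding visit_after_def by measurable

lemma visits_ge_eq_UN: "j \<ge> 1 \<Longrightarrow> visits_ge j = (\<Union>k. visit_at j k)"
  unfolding visits_ge_def visit_at_def ex_rank_eq_iff[symmetric] by blast

lemma visits_ge_sets [measurable]: "j \<ge> 1 \<Longrightarrow> visits_ge j \<in> sets S"
  by (auto simp: visits_ge_eq_UN)

lemma visits_eq_eq_Diff: "visits_eq j = visits_ge j - visits_ge (Suc j)"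
  by (auto simp: visits_eq_def visits_ge_def)

lemma visits_eq_sets [measurable]: "j \<ge> 1 \<Longrightarrow> visits_eq j \<in> sets S"
  by (auto simp: visits_eq_eq_Diff)

text \<open>The rank of a zero strictly increases with its time, so at most one time carries rank
  \<open>j\<close>.\<close>

lemma disjoint_visit_at: "disjoint_family (visit_at j)"
proof -
  have "k \<noteq> l \<Longrightarrow> visit_at j k \<inter> visit_at j l = {}" for k l
  proof (induction k l rule: linorder_wlog)
    case (le k l)
    have False if \<omega>: "\<omega> \<in> visit_at j k" "\<omega> \<in> visit_at j l" for \<omega>
    proof -
      have "l \<in> zeros \<omega> \<inter> {..l}" "l \<notin> zeros \<omega> \<inter> {..k}" using le \<omega> by (auto simp: visit_at_def)
      moreover have "zeros \<omega> \<inter> {..k} \<subseteq> zeros \<omega> \<inter> {..l}" using le by auto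
      ultimately have "zeros \<omega> \<inter> {..k} \<subset> zeros \<omega> \<inter> {..l}" by blast
      then have "card (zeros \<omega> \<inter> {..k}) < card (zeros \<omega> \<inter> {..l})"
        by (intro psubset_card_mono) auto
      then show False using \<omega> by (simp add: visit_at_def)
    qed
    then show ?case by blast
  qed (simp add: Int_commute)
  then show ?thesis by (simp add: disjoint_family_on_def)
qed

text \<open>There are exactly \<open>j\<close> zeros precisely when the \<open>j\<close>-th zero is
  the last, that is, when the walk restarted there never returns.\<close>

lemma visits_eq_eq_UN:
  assumes "j \<ge> 1"
  shows "visits_eq j = (\<Union>k. {\<omega> \<in> visit_at j k. (shift ^^ k) \<omega> \<in> no_return})"
proof (intro equalityI subsetI)
  fix \<omega> assume \<omega>: "\<omega> \<in> visits_eq j"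
  define k where "k = Max (zeros \<omega>)"
  have fin: "finite (zeros \<omega>)" "card (zeros \<omega>) = j" using \<omega> by (auto simp: visits_eq_def)
  have k: "k \<in> zeros \<omega>" "\<And>l. l \<in> zeros \<omega> \<Longrightarrow> l \<le> k"
    unfolding k_def using fin zero_in_zeros[of \<omega>] by (auto intro: Max_in)
  then have "zeros \<omega> \<inter> {..k} = zeros \<omega>" by auto
  then have "\<omega> \<in> visit_at j k" using k fin by (simp add: visit_at_def space_S)
  moreover have "(shift ^^ k) \<omega> \<in> no_return"
    using k by (fastforce simp: no_return_def space_S position_shift zeros_def)
  ultimately show "\<omega> \<in> (\<Union>k. {\<omega> \<in> visit_at j k. (shift ^^ k) \<omega> \<in> no_return})" by blast
next
  fix \<omega> assume "\<omega> \<in> (\<Union>k. {\<omega> \<in> visit_at j k. (shift ^^ k) \<omega> \<in> no_return})"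
  then obtain k where k: "\<omega> \<in> visit_at j k" "(shift ^^ k) \<omega> \<in> no_return" by auto
  have "l \<le> k" if "l \<in> zeros \<omega>" for l
  proof (rule ccontr)
    assume "\<not> l \<le> k"
    then have "l - k \<ge> 1" "k + (l - k) = l" by auto
    then show False
      using k that by (auto simp: no_return_def position_shift visit_at_def zeros_def dest!: spec[of _ "l - k"])
  qed
  then have eq: "zeros \<omega> \<inter> {..k} = zeros \<omega>" by auto
  then have "finite (zeros \<omega>)" by (metis finite_Int finite_atMost)
  then show "\<omega> \<in> visits_eq j" using eq k by (simp add: visits_eq_def visit_at_def)
qed

(* Decomposition over the time of the last visit, after which the walk escapes independently of its past. *)
lemma prob_visits_eq:
  assumes j: "j \<ge> 1"
  shows "P.prob (visits_eq j) = P.prob (visits_ge j) * P.prob no_return"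
proof -
  let ?V = "\<lambda>k. {\<omega> \<in> visit_at j k. (shift ^^ k) \<omega> \<in> no_return}"
  have V_sets: "?V k \<in> sets S" for k
  proof -
    have "?V k = visit_at j k \<inter> ((shift ^^ k) -` no_return \<inter> space S)" by (auto simp: space_S)
    then show ?thesis using measurable_sets[OF measurable_funpow_shift no_return_sets, of k] by auto
  qed
  have "(\<lambda>k. P.prob (visit_at j k)) sums P.prob (visits_ge j)"
    unfolding visits_ge_eq_UN[OF j] by (rule P.finite_measure_UNION) (auto simp: disjoint_visit_at)
  then have "(\<lambda>k. P.prob (visit_at j k) * P.prob no_return) sums (P.prob (visits_ge j) * P.prob no_return)"
    by (rule sums_mult2)
  moreover have "P.prob (?V k) = P.prob (visit_at j k) * P.prob no_return" for k
  proof (rule prob_Int_shift)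
    fix \<omega> \<omega>' :: "nat \<Rightarrow> 'b" assume eq: "\<And>i. i < k \<Longrightarrow> \<omega> i = \<omega>' i"
    have "position \<omega> l = position \<omega>' l" if "l \<le> k" for l
      by (rule position_cong) (use eq that in auto)
    then have "zeros \<omega> \<inter> {..k} = zeros \<omega>' \<inter> {..k}" by (auto simp: zeros_def)
    moreover from this have "k \<in> zeros \<omega> \<longleftrightarrow> k \<in> zeros \<omega>'" by blast
    ultimately show "\<omega> \<in> visit_at j k \<longleftrightarrow> \<omega>' \<in> visit_at j k" by (simp add: visit_at_def space_S)
  qed auto
  moreover have "(\<lambda>k. P.prob (?V k)) sums P.prob (visits_eq j)"
    unfolding visits_eq_eq_UN[OF j]
  proof (rule P.finite_measure_UNION)
    show "disjoint_family ?V"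
      by (rule disjoint_family_subset[OF disjoint_visit_at]) auto
  qed (use V_sets in auto)
  ultimately show ?thesis by (simp add: sums_unique2)
qed

text \<open>The visit at time 0 starts the recursion with probability 1. Each further visit
  multiplies by one minus the escape probability, since having exactly \<open>Suc j\<close> visits
  takes that share of having at least \<open>Suc j\<close>.\<close>

lemma prob_visits_ge: "P.prob (visits_ge (Suc j)) = (1 - P.prob no_return) ^ j"
proof (induction j)
  case 0
  have "visits_ge (Suc 0) = space S"
    using zero_in_zeros by (auto simp: visits_ge_def Suc_le_eq card_gt_0_iff)
  then show ?case using P.prob_space by simp
next
  case (Suc j)
  have "visits_ge (Suc (Suc j)) \<subseteq> visits_ge (Suc j)" by (auto simp: visits_ge_def)
  then have "P.prob (visits_eq (Suc j)) = P.prob (visits_ge (Suc j)) - P.prob (visits_ge (Suc (Suc j)))"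
    unfolding visits_eq_eq_Diff by (intro P.finite_measure_Diff) auto
  then show ?case using Suc by (simp add: prob_visits_eq algebra_simps)
qed

lemma prob_visits_eq_geometric:
  "j \<ge> 1 \<Longrightarrow> P.prob (visits_eq j) = P.prob no_return * (1 - P.prob no_return) ^ (j - 1)"
  using prob_visits_ge[of "j - 1"] by (simp add: prob_visits_eq)

text \<open>These events decrease to the event of infinitely many zeros, which lies in every
  \<open>visits_ge (Suc j)\<close> and is therefore null by the geometric bound.\<close>

lemma prob_visit_after_tendsto_0:
  assumes pos: "P.prob no_return > 0"
  shows "(\<lambda>m. P.prob (visit_after m)) \<longlonglongrightarrow> 0"
proof -
  have "P.prob (\<Inter>m. visit_after m) \<le> (1 - P.prob no_return) ^ j" for j
  proof -
    have "(\<Inter>m. visit_after m) \<subseteq> visits_ge (Suc j)"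
      by (auto simp: visit_after_def visits_ge_def infinite_nat_iff_unbounded)
    then show ?thesis unfolding prob_visits_ge[symmetric] by (intro P.finite_measure_mono) auto
  qed
  moreover have "(\<lambda>j. (1 - P.prob no_return) ^ j) \<longlonglongrightarrow> 0"
    using pos by (intro LIMSEQ_power_zero) auto
  ultimately have "P.prob (\<Inter>m. visit_after m) \<le> 0"
    by (intro LIMSEQ_le_const) auto
  then have "P.prob (\<Inter>m. visit_after m) = 0" using measure_nonneg[of S] by (intro antisym)
  moreover have "(\<lambda>m. P.prob (visit_after m)) \<longlonglongrightarrow> P.prob (\<Inter>m. visit_after m)"
    by (rule P.finite_Lim_measure_decseq) (auto simp: decseq_def visit_after_def intro: le_less_trans)
  ultimately show ?thesis by simp
qed

text \<open>This holds for every path. The two counts can differ at time \<open>i\<close> only if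
  \<open>position \<omega> i\<close> is visited again at some \<open>k > n\<close>. Either
  \<open>k - i > m\<close>, and the restarted walk lies in \<open>visit_after m\<close>, or
  \<open>i\<close> is among the last \<open>m\<close> times.\<close>

lemma later_visits_approx:
  assumes "j \<ge> 1"
  shows "\<bar>real (card {i. i \<le> n \<and> later_visits (position \<omega>) n i = j})
      - (\<Sum>i<Suc n. indicator (visits_eq j) ((shift ^^ i) \<omega>))\<bar>
    \<le> real m + (\<Sum>i<Suc n. indicator (visit_after m) ((shift ^^ i) \<omega>))"
proof -
  let ?a = "\<lambda>i. of_bool (later_visits (position \<omega>) n i = j) :: real"
  have "card {i. i \<le> n \<and> later_visits (position \<omega>) n i = j}
      = (\<Sum>i<Suc n. of_bool (later_visits (position \<omega>) n i = j))"
    by (simp add: sum_of_bool_eq lessThan_Suc_atMost Int_def flip: atMost_def)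
  then have "real (card {i. i \<le> n \<and> later_visits (position \<omega>) n i = j}) = (\<Sum>i<Suc n. ?a i)"
    by simp
  then have "\<bar>real (card {i. i \<le> n \<and> later_visits (position \<omega>) n i = j})
      - (\<Sum>i<Suc n. indicator (visits_eq j) ((shift ^^ i) \<omega>))\<bar>
      = \<bar>\<Sum>i<Suc n. ?a i - indicator (visits_eq j) ((shift ^^ i) \<omega>)\<bar>"
    by (simp only: sum_subtractf)
  also have "\<dots> \<le> (\<Sum>i<Suc n. \<bar>?a i - indicator (visits_eq j) ((shift ^^ i) \<omega>)\<bar>)"
    by (rule sum_abs)
  also have "\<dots> \<le> (\<Sum>i<Suc n. of_bool (n < i + m) + indicator (visit_after m) ((shift ^^ i) \<omega>))"
  proof (rule sum_mono)
    fix i assume "i \<in> {..<Suc n}"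
    then have i: "i \<le> n" by auto
    show "\<bar>?a i - indicator (visits_eq j) ((shift ^^ i) \<omega>)\<bar>
        \<le> of_bool (n < i + m) + indicator (visit_after m) ((shift ^^ i) \<omega>)"
    proof (cases "\<exists>k>n. position \<omega> k = position \<omega> i")
      case False
      then have "?a i = indicator (visits_eq j) ((shift ^^ i) \<omega>)"
        using later_visits_shift[OF _ i, of \<omega>] by (auto simp: visits_eq_def space_S indicator_def)
      then show ?thesis by simp
    next
      case True
      then obtain k where k: "k > n" "position \<omega> k = position \<omega> i" by blast
      have "n < i + m \<or> (shift ^^ i) \<omega> \<in> visit_after m"
      proof (rule disjCI)
        assume "(shift ^^ i) \<omega> \<notin> visit_after m"
        then have "\<not> k - i > m"
          using k i by (auto simp: visit_after_def space_S zeros_shift)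
        then show "n < i + m" using k i by linarith
      qed
      then show ?thesis by (auto simp: indicator_def)
    qed
  qed
  also have "\<dots> = (\<Sum>i<Suc n. of_bool (n < i + m)) + (\<Sum>i<Suc n. indicator (visit_after m) ((shift ^^ i) \<omega>))"
    by (rule sum.distrib)
  also have "(\<Sum>i<Suc n. of_bool (n < i + m)) \<le> real m"
  proof -
    have "(\<Sum>i<Suc n. of_bool (n < i + m)) = real (card ({..<Suc n} \<inter> {i. n < i + m}))"
      by (simp only: sum_of_bool_eq finite_lessThan)
    \<comment> \<open>Truncated subtraction keeps this interval at no more than \<open>m\<close>
      elements also when \<open>m\<close> exceeds \<open>Suc n\<close>.\<close>
    also have "\<dots> \<le> real (card {Suc n - m..<Suc n})"
      by (intro of_nat_mono card_mono) auto
    finally show ?thesis by simp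
  qed
  finally show ?thesis by simp
qed

section \<open>Almost sure limits\<close>

lemma AE_indicator_average:
  assumes A: "A \<in> sets S"
  shows "AE \<omega> in S. (\<lambda>n. (\<Sum>i<n. indicator A ((shift ^^ i) \<omega>)) / real n) \<longlonglongrightarrow> P.prob A"
  using shift.birkhoff[of "indicator A"] A
  by (simp add: shift.birkhoff_sum_def P.emeasure_eq_measure)

text \<open>Labels turn sites into times, and Birkhoff's theorem applies to the event of exactly
  \<open>j\<close> visits and, outside one null set, to all error events
  \<open>visit_after m\<close> together.\<close>

lemma AE_card_occupation_ge:
  assumes pos: "P.prob no_return > 0" and j: "j \<ge> 1"
  shows "AE \<omega> in S. (\<lambda>n. real (card {x. j \<le> occupation (position \<omega>) n x}) / real n)
    \<longlonglongrightarrow> P.prob no_return * (1 - P.prob no_return) ^ (j - 1)"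
proof -
  have "AE \<omega> in S. \<forall>m. (\<lambda>n. (\<Sum>i<n. indicator (visit_after m) ((shift ^^ i) \<omega>)) / real n)
      \<longlonglongrightarrow> P.prob (visit_after m)"
    unfolding AE_all_countable by (intro allI AE_indicator_average visit_after_sets)
  with AE_indicator_average[OF visits_eq_sets[OF j]] show ?thesis
  proof eventually_elim
    case (elim \<omega>)
    let ?a = "\<lambda>n. real (card {x. j \<le> occupation (position \<omega>) n x})"
    \<comment> \<open>The times from 0 to \<open>n\<close> number \<open>Suc n\<close>, so this is
      the normalisation for which the Birkhoff averages appear.\<close>
    have "(\<lambda>n. ?a n / real (Suc n)) \<longlonglongrightarrow> P.prob (visits_eq j)"
    proof (rule tendsto_approx[where b = "\<lambda>m n. (\<Sum>i<Suc n. indicator (visits_eq j) ((shift ^^ i) \<omega>)) / real (Suc n)"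
          and c = "\<lambda>m n. (real m + (\<Sum>i<Suc n. indicator (visit_after m) ((shift ^^ i) \<omega>))) / real (Suc n)"])
      fix m n
      show "\<bar>?a n / real (Suc n) - (\<Sum>i<Suc n. indicator (visits_eq j) ((shift ^^ i) \<omega>)) / real (Suc n)\<bar>
          \<le> (real m + (\<Sum>i<Suc n. indicator (visit_after m) ((shift ^^ i) \<omega>))) / real (Suc n)"
        using later_visits_approx[OF j, of n \<omega> m]
        unfolding card_occupation_ge[OF j] diff_divide_distrib[symmetric] abs_divide abs_of_nat
        by (rule divide_right_mono) simp
    next
      fix m
      show "(\<lambda>n. (\<Sum>i<Suc n. indicator (visits_eq j) ((shift ^^ i) \<omega>)) / real (Suc n)) \<longlonglongrightarrow> P.prob (visits_eq j)"
        by (rule LIMSEQ_Suc[OF elim(1)])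
      have "(\<lambda>n. real m / real (Suc n) + (\<Sum>i<Suc n. indicator (visit_after m) ((shift ^^ i) \<omega>)) / real (Suc n))
          \<longlonglongrightarrow> 0 + P.prob (visit_after m)"
        by (intro tendsto_add LIMSEQ_Suc[OF elim(2)[rule_format]] LIMSEQ_Suc[OF lim_const_over_n])
      then show "(\<lambda>n. (real m + (\<Sum>i<Suc n. indicator (visit_after m) ((shift ^^ i) \<omega>))) / real (Suc n))
          \<longlonglongrightarrow> P.prob (visit_after m)"
        by (simp only: add_divide_distrib add_0)
    qed (auto intro: prob_visit_after_tendsto_0[OF pos])
    \<comment> \<open>A factor tending to 1 replaces the divisor \<open>Suc n\<close> by
      \<open>n\<close>.\<close>
    then have "(\<lambda>n. ?a n / real (Suc n) * (real (Suc n) / real n)) \<longlonglongrightarrow> P.prob (visits_eq j) * 1"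
      by (intro tendsto_mult LIMSEQ_Suc_n_over_n)
    then have "(\<lambda>n. ?a n / real n) \<longlonglongrightarrow> P.prob (visits_eq j)" by simp
    then show ?case using j by (simp add: prob_visits_eq_geometric)
  qed
qed

text \<open>Countably many thresholds \<open>j\<close> share one null set; off it, the limit for
  \<open>J\<close> is a deterministic consequence.\<close>

theorem AE_card_occupation:
  assumes pos: "P.prob no_return > 0" and J: "J \<subseteq> {1..}"
  shows "AE \<omega> in S. (\<lambda>n. real (card {x. occupation (position \<omega>) n x \<in> J}) / real n)
    \<longlonglongrightarrow> (\<Sum>\<^sub>\<infinity>j\<in>J. (P.prob no_return)\<^sup>2 * (1 - P.prob no_return) ^ (j - 1))"
proof -
  have "AE \<omega> in S. \<forall>j\<in>{1..}. (\<lambda>n. real (card {x. j \<le> occupation (position \<omega>) n x}) / real n)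
    \<longlonglongrightarrow> P.prob no_return * (1 - P.prob no_return) ^ (j - 1)"
    using AE_card_occupation_ge[OF pos] by (subst AE_ball_countable) auto
  then show ?thesis
  proof eventually_elim
    case (elim \<omega>)
    then show ?case using pos J by (intro card_occupation_limit) auto
  qed
qed

end

section \<open>Random walks on the integer lattice\<close>

lemma walk_eq_position: "walk X n \<omega> = position (\<lambda>i. X (Suc i) \<omega>) n"
  by (simp add: walk_def position_def sum.atLeast1_atMost_eq)

lemma local_time_eq_occupation: "local_time X n x \<omega> = occupation (position (\<lambda>i. X (Suc i) \<omega>)) n x"
proof -
  have "local_time X n x \<omega> = card ({0..n} \<inter> {i. walk X i \<omega> = x})"
    by (simp add: local_time_def sum_of_bool_eq)
  also have "{0..n} \<inter> {i. walk X i \<omega> = x} = {k. k \<le> n \<and> position (\<lambda>i. X (Suc i) \<omega>) k = x}"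
    by (auto simp: walk_eq_position)
  finally show ?thesis by (simp add: occupation_def)
qed

text \<open>The steps are independent over \<open>{1..}\<close>, so their joint law is first a
  product there; reindexing along the injective \<open>Suc\<close> moves it to the coordinate space
  of the shift.\<close>

lemma distr_steps:
  fixes X :: "nat \<Rightarrow> 'a \<Rightarrow> int ^ 'd"
  assumes "prob_space M" and "iid_steps M X"
  defines "\<mu> \<equiv> distr M (count_space UNIV) (X 1)"
  shows "(\<lambda>\<omega> i. X (Suc i) \<omega>) \<in> M \<rightarrow>\<^sub>M (\<Pi>\<^sub>M i\<in>UNIV. \<mu>)"
    and "distr M (\<Pi>\<^sub>M i\<in>UNIV. \<mu>) (\<lambda>\<omega> i. X (Suc i) \<omega>) = (\<Pi>\<^sub>M i\<in>UNIV. \<mu>)"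
proof -
  interpret prob_space M by fact
  have indep: "indep_vars (\<lambda>_. count_space UNIV) X {1..}"
    and ident: "\<And>i. i \<ge> 1 \<Longrightarrow> distr M (count_space UNIV) (X i) = \<mu>"
    using assms(2) unfolding iid_steps_def \<mu>_def by blast+
  have X: "X i \<in> M \<rightarrow>\<^sub>M count_space UNIV" if "i \<ge> 1" for i
    using indep that by (auto simp: indep_vars_def)
  interpret \<mu>: prob_space \<mu> unfolding \<mu>_def by (rule prob_space_distr) (simp add: X)
  \<comment> \<open>Both products carry the same sigma-algebra, so measurability passes between the
    discrete spaces and the step law.\<close>
  have sets: "sets (PiM I (\<lambda>_. \<mu>)) = sets (PiM I (\<lambda>_. count_space UNIV))" for I :: "nat set"
    by (intro sets_PiM_cong) (auto simp: \<mu>_def)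
  have "(\<lambda>\<omega> i. X (Suc i) \<omega>) \<in> M \<rightarrow>\<^sub>M (\<Pi>\<^sub>M i\<in>(UNIV::nat set). count_space UNIV)"
    by (rule measurable_PiM_single') (auto simp: X)
  then show "(\<lambda>\<omega> i. X (Suc i) \<omega>) \<in> M \<rightarrow>\<^sub>M (\<Pi>\<^sub>M i\<in>UNIV. \<mu>)"
    by (simp only: measurable_cong_sets[OF refl sets])
  let ?R = "\<lambda>\<omega>. \<lambda>i\<in>{1..}. X i \<omega>"
  have R: "?R \<in> M \<rightarrow>\<^sub>M (\<Pi>\<^sub>M i\<in>{1..}. count_space UNIV)"
    by (rule measurable_restrict) (simp add: X)
  have "distr M (\<Pi>\<^sub>M i\<in>{1..}. count_space UNIV) ?R = (\<Pi>\<^sub>M i\<in>{1..}. distr M (count_space UNIV) (X i))"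
    using indep by (subst (asm) indep_vars_iff_distr_eq_PiM') (auto simp: X)
  also have "\<dots> = (\<Pi>\<^sub>M i\<in>{1..}. \<mu>)" by (rule PiM_cong) (auto simp: ident)
  finally have R_distr: "distr M (\<Pi>\<^sub>M i\<in>{1..}. \<mu>) ?R = (\<Pi>\<^sub>M i\<in>{1..}. \<mu>)"
    using distr_cong[OF refl sets refl, of M "{1..}" ?R] by simp
  let ?S = "\<lambda>\<omega>::nat \<Rightarrow> int ^ 'd. \<lambda>i\<in>UNIV. \<omega> (Suc i)"
  have "distr (\<Pi>\<^sub>M i\<in>{1..}. \<mu>) (\<Pi>\<^sub>M i\<in>UNIV. \<mu>) ?S = (\<Pi>\<^sub>M i\<in>UNIV. \<mu>)"
    by (rule distr_PiM_reindex) (auto intro: \<mu>.prob_space_axioms)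
  then have "(\<Pi>\<^sub>M i\<in>UNIV. \<mu>) = distr (distr M (\<Pi>\<^sub>M i\<in>{1..}. \<mu>) ?R) (\<Pi>\<^sub>M i\<in>UNIV. \<mu>) ?S"
    unfolding R_distr ..
  also have "\<dots> = distr M (\<Pi>\<^sub>M i\<in>UNIV. \<mu>) (?S \<circ> ?R)"
  proof (rule distr_distr)
    show "?S \<in> (\<Pi>\<^sub>M i\<in>{1..}. \<mu>) \<rightarrow>\<^sub>M (\<Pi>\<^sub>M i\<in>UNIV. \<mu>)"
      by (intro measurable_restrict measurable_component_singleton) auto
    show "?R \<in> M \<rightarrow>\<^sub>M (\<Pi>\<^sub>M i\<in>{1..}. \<mu>)"
      using R by (simp only: measurable_cong_sets[OF refl sets])
  qed
  also have "?S \<circ> ?R = (\<lambda>\<omega> i. X (Suc i) \<omega>)" by (simp add: fun_eq_iff)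
  finally show "distr M (\<Pi>\<^sub>M i\<in>UNIV. \<mu>) (\<lambda>\<omega> i. X (Suc i) \<omega>) = (\<Pi>\<^sub>M i\<in>UNIV. \<mu>)" ..
qed

theorem corollary3:
  fixes M :: "'a measure"
    and X :: "nat \<Rightarrow> 'a \<Rightarrow> int ^ 'd"
    and J :: "nat set"
  assumes "prob_space M"
    and "iid_steps M X"
    and "transient M X"
    and "escape_prob M X < 1"
    and "J \<subseteq> {1..}"
  shows "AE \<omega> in M.
    (\<lambda>n. 1 / real n * (\<Sum>\<^sub>\<infinity>x\<in>UNIV. of_bool (local_time X n x \<omega> \<in> J)))
      \<longlonglongrightarrow> (\<Sum>\<^sub>\<infinity>j\<in>J. (escape_prob M X)\<^sup>2 * (1 - escape_prob M X) ^ (j - 1))"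
proof -
  interpret prob_space M by fact
  define \<mu> where "\<mu> = distr M (count_space UNIV) (X 1)"
  define Y where "Y = (\<lambda>\<omega> i. X (Suc i) \<omega>)"
  have Y [measurable]: "Y \<in> M \<rightarrow>\<^sub>M (\<Pi>\<^sub>M i\<in>UNIV. \<mu>)"
    and distr_Y: "distr M (\<Pi>\<^sub>M i\<in>UNIV. \<mu>) Y = (\<Pi>\<^sub>M i\<in>UNIV. \<mu>)"
    unfolding Y_def \<mu>_def by (rule distr_steps[OF assms(1,2)])+
  have "X 1 \<in> M \<rightarrow>\<^sub>M count_space UNIV"
    using assms(2) unfolding iid_steps_def indep_vars_def by (meson atLeast_iff order_refl)
  then interpret \<mu>: prob_space \<mu> unfolding \<mu>_def by (rule prob_space_distr)
  interpret W: group_walk \<mu>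
    by unfold_locales (simp add: \<mu>_def)
  have escape: "W.P.prob W.no_return = escape_prob M X"
  proof -
    have "W.P.prob W.no_return = measure (distr M (\<Pi>\<^sub>M i\<in>UNIV. \<mu>) Y) W.no_return"
      by (simp add: distr_Y)
    also have "\<dots> = measure M (Y -` W.no_return \<inter> space M)"
      by (rule measure_distr) auto
    also have "Y -` W.no_return \<inter> space M = {\<omega> \<in> space M. \<forall>n\<ge>1. walk X n \<omega> \<noteq> 0}"
      by (auto simp: W.no_return_def W.space_S walk_eq_position Y_def)
    finally show ?thesis by (simp add: escape_prob_def)
  qed
  have "AE \<omega> in distr M (\<Pi>\<^sub>M i\<in>UNIV. \<mu>) Y.
      (\<lambda>n. real (card {x. occupation (position \<omega>) n x \<in> J}) / real n)
        \<longlonglongrightarrow> (\<Sum>\<^sub>\<infinity>j\<in>J. (escape_prob M X)\<^sup>2 * (1 - escape_prob M X) ^ (j - 1))"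
    using W.AE_card_occupation[of J] assms(3,5) unfolding distr_Y escape transient_def by blast
  then have "AE \<omega> in M. (\<lambda>n. real (card {x. occupation (position (Y \<omega>)) n x \<in> J}) / real n)
        \<longlonglongrightarrow> (\<Sum>\<^sub>\<infinity>j\<in>J. (escape_prob M X)\<^sup>2 * (1 - escape_prob M X) ^ (j - 1))"
    by (rule AE_distrD[OF Y])
  moreover have "(\<Sum>\<^sub>\<infinity>x\<in>UNIV. of_bool (local_time X n x \<omega> \<in> J))
      = real (card {x. occupation (position (Y \<omega>)) n x \<in> J})" for n \<omega>
  proof -
    let ?A = "{x. occupation (position (Y \<omega>)) n x \<in> J}"
    \<comment> \<open>As 0 is not in \<open>J\<close>, only visited sites contribute; finiteness
      makes the unordered sum an actual count.\<close>
    have fin: "finite ?A" using assms(5) by (intro finite_occupied) auto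
    have "(\<Sum>\<^sub>\<infinity>x\<in>UNIV. of_bool (local_time X n x \<omega> \<in> J)) = (\<Sum>\<^sub>\<infinity>x\<in>?A. (1::real))"
      by (rule infsum_cong_neutral) (auto simp: local_time_eq_occupation Y_def)
    also have "\<dots> = real (card ?A)" using fin by simp
    finally show ?thesis .
  qed
  ultimately show ?thesis by simp
qed

end
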